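(* Let $D\subset\mathbb{R}^2$ be a bounded domain, let $\ell\geq 1$ be an integer, and let $\Omega\in\mathcal{C}_\ell(D)$. For every sufficiently small $\varepsilon>0$, there exists a connected open set $\Omega_\varepsilon$ with $C^\infty$ boundary such that $$\Omega_\varepsilon\Subset\Omega,\qquad \#\mathrm{cc}(\overline{D}\setminus\Omega_\varepsilon)\leq\#\mathrm{cc}(\overline{D}\setminus\Omega),$$ $$\Omega\setminus\Omega_\varepsilon\subset\{x\in\Omega:\ \mathrm{dist}(x,\partial\Omega)<\varepsilon\},\qquad d_{H^c}(\Omega_\varepsilon,\Omega)\leq\varepsilon.$$ In particular, smooth domains (elements of $\mathcal{C}_\ell(D)$ with $C^\infty$ boundary) are dense in $\mathcal{C}_\ell(D)$ for the metric $d_{H^c}$.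
   Context: A domain is a nonempty connected open set. For a bounded domain $D\subset\mathbb{R}^2$ and an integer $\ell\ge 1$, $\mathcal{C}_\ell(D)$ is the set of nonempty connected open sets $\Omega\subset D$ such that $\overline{D}\setminus\Omega$ has at most $\ell$ connected components. For open sets $\Omega_1,\Omega_2\subset D$, $d_{H^c}(\Omega_1,\Omega_2):=d_H(\overline{D}\setminus\Omega_1,\overline{D}\setminus\Omega_2)$, where $d_H$ is the Hausdorff distance between nonempty compact subsets of $\overline{D}$. The notation $\mathrm{cc}(X)$ is the set of connected components of a topological space $X$ and $\#\mathrm{cc}(X)$ its cardinality (when finite). $A\Subset B$ means that $\overline{A}$ is compact and contained in $B$. *)

theory Defs
  imports "HOL-Analysis.Analysis"
begin

definition is_domain :: "'a::topological_space set \<Rightarrow> bool" where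
  "is_domain A \<longleftrightarrow> A \<noteq> {} \<and> connected A \<and> open A"

definition compactly_contained :: "'a::topological_space set \<Rightarrow> 'a set \<Rightarrow> bool"
    (infix "\<Subset>" 50) where
  "A \<Subset> B \<longleftrightarrow> compact (closure A) \<and> closure A \<subseteq> B"

text \<open>The finiteness clause is needed because \<^const>\<open>card\<close> is 0 on infinite sets.\<close>

definition C_class :: "nat \<Rightarrow> (real^2) set \<Rightarrow> (real^2) set set" where
  "C_class l D = {\<Omega>. is_domain \<Omega> \<and> \<Omega> \<subseteq> D \<and>
     finite (components (closure D - \<Omega>)) \<and> card (components (closure D - \<Omega>)) \<le> l}"

text \<open>The suprema range over real numbers, so this is the Hausdorff distance only for
  nonempty bounded sets (in particular for nonempty compact ones).\<close>

definition hausdorff_distance :: "'a::metric_space set \<Rightarrow> 'a set \<Rightarrow> real" where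
  "hausdorff_distance A B = max (SUP a\<in>A. infdist a B) (SUP b\<in>B. infdist b A)"

text \<open>If \<open>D\<close> is nonempty, open and bounded and \<open>\<Omega> \<subseteq> D\<close> is open, then \<open>closure D - \<Omega>\<close> is
  compact and contains the nonempty set \<open>frontier D\<close>.\<close>

definition complementary_hausdorff_distance ::
    "(real^2) set \<Rightarrow> (real^2) set \<Rightarrow> (real^2) set \<Rightarrow> real" where
  "complementary_hausdorff_distance D \<Omega>\<^sub>1 \<Omega>\<^sub>2 =
     hausdorff_distance (closure D - \<Omega>\<^sub>1) (closure D - \<Omega>\<^sub>2)"

definition smooth_real_on :: "real set \<Rightarrow> (real \<Rightarrow> real) \<Rightarrow> bool" where
  "smooth_real_on I g \<longleftrightarrow> (\<forall>k. \<forall>t\<in>I. (deriv ^^ k) g field_differentiable at t)"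

text \<open>Near each boundary point, in suitable orthonormal coordinates (given by \<open>A\<close>), the set is
  the strict epigraph of a smooth function of the first coordinate. No translation is needed,
  since \<open>g\<close> is arbitrary; reflections are allowed, so ``above the graph'' is no restriction.
  The function only has to be defined over the first coordinates of points of \<open>U\<close>.\<close>

definition smooth_boundary :: "(real^2) set \<Rightarrow> bool" where
  "smooth_boundary \<Omega> \<longleftrightarrow>
     (\<forall>x\<in>frontier \<Omega>. \<exists>U A I g.
        open U \<and> x \<in> U \<and>
        orthogonal_transformation (A :: real^2 \<Rightarrow> real^2) \<and>
        open I \<and> (\<forall>y\<in>U. A y $ 1 \<in> I) \<and> smooth_real_on I g \<and>
        \<Omega> \<inter> U = {y \<in> U. g (A y $ 1) < A y $ 2})"

end

theory Submission
  imports Defs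
begin

text \<open>The approximating domain is bounded by pieces of a regular level curve of a polynomial.

Let \<open>K = closure D - \<Omega>\<close>, and let \<open>L\<close> be a compact connected subset of \<open>\<Omega>\<close> that contains every
point of \<open>\<Omega>\<close> at distance at least \<open>\<epsilon>\<close> from \<open>frontier \<Omega>\<close>
(\<open>compact_subset_connected_compact\<close>). By the Stone--Weierstrass theorem some polynomial \<open>P\<close> is
negative on \<open>K\<close> and positive on \<open>L\<close>. After adding a small affine function to \<open>P\<close>, its gradient
vanishes nowhere on the zero set
(\<open>regular_polynomial_separating_compact_sets\<close>). The affine functions that fail correspond to the
tangent planes of the graph of \<open>P\<close>, which form a two-parameter family inside a
three-dimensional space and so a null set; the full theorem of Sard is avoided.

Let \<open>V\<close> be the component of \<open>{x \<in> \<Omega>. 0 < P x}\<close> that contains \<open>L\<close>. Since \<open>P\<close> is negative on \<open>K\<close>,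
the closure of \<open>V\<close> lies in \<open>\<Omega>\<close>, and \<open>P\<close> vanishes on \<open>frontier V\<close>. The complement of \<open>V\<close> may however
have more components than \<open>K\<close>. Those that do not meet \<open>K\<close> are holes inside \<open>\<Omega>\<close>, and adding them to
\<open>V\<close> gives an open connected \<open>V'\<close> such that every component of \<open>closure D - V'\<close> meets \<open>K\<close>
(\<open>hole_filling\<close>); hence there are no more of them than components of \<open>K\<close>. Filling holes
creates no new boundary points, and near a boundary point that survives it changes nothing, because
there the complement of \<open>V\<close> is connected. As \<open>L \<subseteq> V'\<close>, everything in \<open>\<Omega> - V'\<close>
lies within \<open>\<epsilon>\<close> of \<open>frontier \<Omega> \<subseteq> K\<close>, which bounds the Hausdorff distance as well.

It remains to see that a regular zero set is locally a smooth graph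
(\<open>regular_zero_locally_smooth_graph\<close>). The implicit function \<open>g\<close> satisfies a differential equation
whose right-hand side is a quotient of polynomials evaluated along the graph, and the functions of
this shape are closed under differentiation; so all derivatives of \<open>g\<close> exist
(\<open>smooth_implicit_function\<close>).\<close>

section \<open>Polynomials with a regular zero set\<close>

lemma real_polynomial_function_has_gradient:
  fixes p :: "'a::euclidean_space \<Rightarrow> real"
  assumes "real_polynomial_function p"
  obtains G where "polynomial_function G"
    and "\<And>x. (p has_derivative (\<lambda>h. G x \<bullet> h)) (at x)"
proof -
  have "\<exists>G. polynomial_function G \<and> (\<forall>x. (p has_derivative (\<lambda>h. G x \<bullet> h)) (at x))"
    using assms
  proof (induction p rule: real_polynomial_function.induct)
    case (linear f)
    have "f h = (\<Sum>b\<in>Basis. f b *\<^sub>R b) \<bullet> h" for h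
    proof -
      have "f h = f (\<Sum>b\<in>Basis. (h \<bullet> b) *\<^sub>R b)"
        by (simp add: euclidean_representation)
      also have "\<dots> = (\<Sum>b\<in>Basis. (h \<bullet> b) * f b)"
        using linear by (simp add: bounded_linear.linear linear_sum linear_scale)
      finally show ?thesis
        by (simp add: inner_sum_left inner_commute[of h] mult.commute)
    qed
    then have "(\<lambda>h. (\<Sum>b\<in>Basis. f b *\<^sub>R b) \<bullet> h) = f" by (intro ext) (rule sym)
    then have "(f has_derivative (\<lambda>h. (\<Sum>b\<in>Basis. f b *\<^sub>R b) \<bullet> h)) (at x)" for x
      using bounded_linear_imp_has_derivative[OF linear, of "at x"] by (simp only:)
    then show ?case
      by (intro exI[of _ "\<lambda>x. \<Sum>b\<in>Basis. f b *\<^sub>R b"]) simp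
  next
    case (const c)
    show ?case
      by (intro exI[of _ "\<lambda>x. 0"]) simp
  next
    case (add f g)
    from add.IH obtain F H where "polynomial_function F" "\<And>x. (f has_derivative (\<lambda>h. F x \<bullet> h)) (at x)"
      "polynomial_function H" "\<And>x. (g has_derivative (\<lambda>h. H x \<bullet> h)) (at x)"
      by (elim exE conjE) metis
    then show ?case
      by (intro exI[of _ "\<lambda>x. F x + H x"])
        (auto simp: inner_add_left intro!: has_derivative_add)
  next
    case (mult f g)
    from mult.IH obtain F H where FH: "polynomial_function F" "\<And>x. (f has_derivative (\<lambda>h. F x \<bullet> h)) (at x)"
      "polynomial_function H" "\<And>x. (g has_derivative (\<lambda>h. H x \<bullet> h)) (at x)"
      by (elim exE conjE) metis
    have "((\<lambda>x. f x * g x) has_derivative (\<lambda>h. (f x *\<^sub>R H x + g x *\<^sub>R F x) \<bullet> h)) (at x)" for x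
      using has_derivative_mult[OF FH(2) FH(4), of x]
      by (simp add: inner_add_left algebra_simps)
    moreover have "polynomial_function (\<lambda>x. f x *\<^sub>R H x + g x *\<^sub>R F x)"
      using mult FH by (auto simp: real_polynomial_function_eq)
    ultimately show ?case by blast
  qed
  then show ?thesis using that by blast
qed

text \<open>An affine function \<open>x \<mapsto> a \<bullet> x + c\<close> is bad when \<open>- a \<bullet> x - c\<close> is tangent to the graph of \<open>p\<close> at some
point \<open>x\<close>. Then \<open>(a, c)\<close> is the value at \<open>x\<close> of a differentiable map into a space with one more
dimension, whose range is null; so arbitrarily small good pairs exist.\<close>

lemma regular_value_affine_perturbation:
  fixes p :: "'a::euclidean_space \<Rightarrow> real"
  assumes p: "real_polynomial_function p" and G: "polynomial_function G"
    and "\<delta> > 0"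
  obtains a c where "norm a < \<delta>" "\<bar>c\<bar> < \<delta>" "\<And>x. p x + a \<bullet> x + c = 0 \<Longrightarrow> G x + a \<noteq> 0"
proof -
  define T where "T x = (- G x, G x \<bullet> x - p x)" for x
  have "(\<lambda>x. - G x) differentiable_on UNIV" "(\<lambda>x. G x \<bullet> x - p x) differentiable_on UNIV"
    using differentiable_on_polynomial_function[OF G] differentiable_on_real_polynomial_function[OF p]
    by (auto simp: differentiable_on_def
        intro!: differentiable_minus differentiable_diff differentiable_inner)
  then have "T differentiable_on UNIV"
    unfolding T_def differentiable_on_def differentiable_def
    by (metis has_derivative_Pair)
  then have neg: "negligible (range T)"
    by (intro negligible_differentiable_image_lowdim) simp_all
  \<comment> \<open>A nonempty open set of pairs cannot lie in the null set \<open>range T\<close>.\<close>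
  have "open (ball (0::'a) \<delta> \<times> ball (0::real) \<delta>)" "ball (0::'a) \<delta> \<times> ball (0::real) \<delta> \<noteq> {}"
    using \<open>\<delta> > 0\<close> by (auto intro: open_Times)
  then have "\<not> ball (0::'a) \<delta> \<times> ball (0::real) \<delta> \<subseteq> range T"
    using open_not_negligible neg negligible_subset by blast
  then obtain z where "z \<in> ball 0 \<delta> \<times> ball 0 \<delta>" "z \<notin> range T"
    by blast
  then obtain a c where ac: "norm a < \<delta>" "\<bar>c\<bar> < \<delta>" "(a, c) \<notin> range T"
    by (cases z) auto
  have "G x + a \<noteq> 0" if "p x + a \<bullet> x + c = 0" for x
  proof
    assume "G x + a = 0"
    then have "a = - G x" by (simp add: add_eq_0_iff)
    moreover have "c = - p x - a \<bullet> x"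
      using that by linarith
    ultimately have "(a, c) = T x" by (simp add: T_def)
    with ac show False by blast
  qed
  with ac that show ?thesis by blast
qed

lemma regular_polynomial_separating_compact_sets:
  fixes K L :: "'a::euclidean_space set"
  assumes "compact K" "compact L" "K \<inter> L = {}"
  obtains P G where "real_polynomial_function P" "polynomial_function G"
    and "\<And>x. (P has_derivative (\<lambda>h. G x \<bullet> h)) (at x)"
    and "\<And>x. x \<in> K \<Longrightarrow> P x < 0" "\<And>x. x \<in> L \<Longrightarrow> P x > 0"
    and "\<And>x. P x = 0 \<Longrightarrow> G x \<noteq> 0"
proof -
  obtain u :: "'a \<Rightarrow> real" where u: "continuous_on UNIV u"
    "\<And>x. x \<in> K \<Longrightarrow> u x = -1" "\<And>x. x \<in> L \<Longrightarrow> u x = 1"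
    using Urysohn[OF compact_imp_closed[OF assms(1)] compact_imp_closed[OF assms(2)] assms(3), of "-1" 1]
    by metis
  have "compact (K \<union> L)" using assms by blast
  obtain p where p: "real_polynomial_function p" "\<And>x. x \<in> K \<union> L \<Longrightarrow> \<bar>u x - p x\<bar> < 1/2"
    using Stone_Weierstrass_real_polynomial_function[OF \<open>compact (K \<union> L)\<close> continuous_on_subset[OF u(1)], of "1/2"]
    by auto
  obtain G where G: "polynomial_function G" "\<And>x. (p has_derivative (\<lambda>h. G x \<bullet> h)) (at x)"
    using real_polynomial_function_has_gradient[OF p(1)] by blast
  obtain M where M: "M > 0" "\<And>x. x \<in> K \<union> L \<Longrightarrow> norm x \<le> M"
    using compact_imp_bounded[OF \<open>compact (K \<union> L)\<close>] bounded_pos by metis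
  \<comment> \<open>The perturbation \<open>a \<bullet> x + c\<close> then stays below the remaining margin \<open>1/2\<close> on \<open>K \<union> L\<close>.\<close>
  define \<delta> where "\<delta> = 1 / (2 * (M + 1))"
  have \<delta>: "\<delta> > 0" "\<delta> * M + \<delta> = 1/2"
    using M(1) by (auto simp: \<delta>_def field_simps)
  obtain a c where ac: "norm a < \<delta>" "\<bar>c\<bar> < \<delta>" "\<And>x. p x + a \<bullet> x + c = 0 \<Longrightarrow> G x + a \<noteq> 0"
    using regular_value_affine_perturbation[OF p(1) G(1) \<delta>(1)] by metis
  have small: "\<bar>a \<bullet> x + c\<bar> < 1/2" if "x \<in> K \<union> L" for x
  proof -
    have "\<bar>a \<bullet> x\<bar> \<le> norm a * norm x" by (rule Cauchy_Schwarz_ineq2)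
    also have "\<dots> \<le> \<delta> * M" using ac(1) M that \<delta>(1) by (intro mult_mono) auto
    finally show ?thesis using ac(2) \<delta>(2) by linarith
  qed
  show ?thesis
  proof
    show "real_polynomial_function (\<lambda>x. p x + a \<bullet> x + c)"
      by (intro real_polynomial_function.intros(3) p(1) real_polynomial_function.intros(1)
          real_polynomial_function.intros(2) bounded_linear_inner_right)
    show "polynomial_function (\<lambda>x. G x + a)"
      using G(1) by auto
    show "((\<lambda>x. p x + a \<bullet> x + c) has_derivative (\<lambda>h. (G x + a) \<bullet> h)) (at x)" for x
      using G(2)[of x] by (auto intro!: derivative_eq_intros simp: inner_add_left)
    show "p x + a \<bullet> x + c < 0" if "x \<in> K" for x
      using p(2)[of x] u(2)[OF that] small[of x] that unfolding Un_iff abs_less_iff by linarith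
    show "p x + a \<bullet> x + c > 0" if "x \<in> L" for x
      using p(2)[of x] u(3)[OF that] small[of x] that unfolding Un_iff abs_less_iff by linarith
  qed (use ac(3) in blast)
qed

section \<open>Smooth implicit functions\<close>

text \<open>Smoothness without computing a single higher derivative: it suffices to place the function in some
class whose members all have a derivative that again belongs to the class.\<close>

lemma smooth_real_on_derivative_closed:
  assumes "open I" "f \<in> S"
    and closed: "\<And>h. h \<in> S \<Longrightarrow> \<exists>h'\<in>S. \<forall>t\<in>I. (h has_real_derivative h' t) (at t)"
  shows "smooth_real_on I f"
proof -
  have step: "((deriv ^^ k) f has_real_derivative h' t) (at t)"
    if "\<And>t. t \<in> I \<Longrightarrow> (deriv ^^ k) f t = h t" "\<And>t. t \<in> I \<Longrightarrow> (h has_real_derivative h' t) (at t)" "t \<in> I"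
    for k h h' t
    by (rule has_field_derivative_transform_within_open[OF that(2) \<open>open I\<close> \<open>t \<in> I\<close>]) (use that in auto)
  have ex: "\<exists>h\<in>S. \<forall>t\<in>I. (deriv ^^ k) f t = h t" for k
  proof (induction k)
    case 0
    then show ?case using \<open>f \<in> S\<close> by auto
  next
    case (Suc k)
    then obtain h where "h \<in> S" and h: "\<And>t. t \<in> I \<Longrightarrow> (deriv ^^ k) f t = h t" by blast
    then obtain h' where "h' \<in> S" and h': "\<And>t. t \<in> I \<Longrightarrow> (h has_real_derivative h' t) (at t)"
      using closed by blast
    have "(deriv ^^ Suc k) f t = h' t" if "t \<in> I" for t
      using DERIV_imp_deriv[OF step[OF h h' that]] by simp
    with \<open>h' \<in> S\<close> show ?case by blast
  qed
  have "(deriv ^^ k) f field_differentiable at t" if t: "t \<in> I" for k t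
  proof -
    from ex[of k] obtain h where "h \<in> S" and h: "\<And>t. t \<in> I \<Longrightarrow> (deriv ^^ k) f t = h t" by blast
    then obtain h' where h': "\<And>t. t \<in> I \<Longrightarrow> (h has_real_derivative h' t) (at t)"
      using closed by blast
    show ?thesis using step[OF h h' t] by (auto simp: field_differentiable_def)
  qed
  then show ?thesis by (simp add: smooth_real_on_def)
qed

text \<open>Write \<open>\<gamma> t = t *\<^sub>R e + g t *\<^sub>R f\<close> and let \<open>q1\<close>, \<open>q2\<close> be the components of \<open>G\<close> along \<open>e\<close>, \<open>f\<close>. The
hypothesis says \<open>g' = - q1 / q2\<close> along \<open>\<gamma>\<close>. The class of functions \<open>R (\<gamma> t) / q2 (\<gamma> t) ^ m\<close> with \<open>R\<close>
a polynomial contains \<open>g\<close> and is closed under differentiation: every derivative brings in at most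
two further factors \<open>q2\<close> in the denominator.\<close>

lemma smooth_implicit_function:
  fixes P :: "'a::euclidean_space \<Rightarrow> real" and e f :: 'a
  assumes G: "polynomial_function G"
    and "open I"
    and g: "\<And>t. t \<in> I \<Longrightarrow> (g has_real_derivative
        - (G (t *\<^sub>R e + g t *\<^sub>R f) \<bullet> e) / (G (t *\<^sub>R e + g t *\<^sub>R f) \<bullet> f)) (at t)"
    and nz: "\<And>t. t \<in> I \<Longrightarrow> G (t *\<^sub>R e + g t *\<^sub>R f) \<bullet> f \<noteq> 0"
    and coord: "f \<bullet> f = 1" "e \<bullet> f = 0"
  shows "smooth_real_on I g"
proof -
  define \<gamma> where "\<gamma> t = t *\<^sub>R e + g t *\<^sub>R f" for t
  define q1 where "q1 x = G x \<bullet> e" for x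
  define q2 where "q2 x = G x \<bullet> f" for x
  have q: "real_polynomial_function q1" "real_polynomial_function q2"
    using G by (auto simp: real_polynomial_function_eq q1_def[abs_def] q2_def[abs_def])
  define S where "S = {(\<lambda>t. R (\<gamma> t) / q2 (\<gamma> t) ^ m) | R m. real_polynomial_function R}"
  have nz': "q2 (\<gamma> t) \<noteq> 0" if "t \<in> I" for t using nz[OF that] by (simp add: \<gamma>_def q2_def)
  have g': "(g has_real_derivative - q1 (\<gamma> t) / q2 (\<gamma> t)) (at t)" if "t \<in> I" for t
    using g[OF that] by (simp add: \<gamma>_def q1_def q2_def)
  have \<gamma>': "(\<gamma> has_derivative (\<lambda>h. h *\<^sub>R (e - (q1 (\<gamma> t) / q2 (\<gamma> t)) *\<^sub>R f))) (at t)" if "t \<in> I" for t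
    unfolding \<gamma>_def[abs_def]
    using g'[OF that, unfolded has_field_derivative_def]
    by (auto intro!: derivative_eq_intros simp: algebra_simps \<gamma>_def)
  have along: "((\<lambda>t. R (\<gamma> t)) has_real_derivative (D (\<gamma> t) \<bullet> e - D (\<gamma> t) \<bullet> f * q1 (\<gamma> t) / q2 (\<gamma> t))) (at t)"
    if D: "\<And>x. (R has_derivative (\<lambda>h. D x \<bullet> h)) (at x)" and "t \<in> I" for R D t
  proof (rule has_derivative_imp_has_field_derivative[OF has_derivative_compose[OF \<gamma>'[OF \<open>t \<in> I\<close>] D]])
    show "h * (D (\<gamma> t) \<bullet> e - D (\<gamma> t) \<bullet> f * q1 (\<gamma> t) / q2 (\<gamma> t)) =
        D (\<gamma> t) \<bullet> (h *\<^sub>R (e - (q1 (\<gamma> t) / q2 (\<gamma> t)) *\<^sub>R f))" for h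
      by (simp add: inner_diff_right)
  qed
  have "g = (\<lambda>t. (\<gamma> t \<bullet> f) / q2 (\<gamma> t) ^ 0)"
    using coord by (auto simp: \<gamma>_def inner_add_left)
  then have "g \<in> S"
    unfolding S_def
    by (intro CollectI exI[of _ "\<lambda>x. x \<bullet> f"] exI[of _ "0::nat"] conjI
        real_polynomial_function.intros(1) bounded_linear_inner_left)
  moreover have "\<exists>h'\<in>S. \<forall>t\<in>I. (h has_real_derivative h' t) (at t)" if "h \<in> S" for h
  proof -
    obtain R m where R: "real_polynomial_function R" and h: "h = (\<lambda>t. R (\<gamma> t) / q2 (\<gamma> t) ^ m)"
      using \<open>h \<in> S\<close> by (auto simp: S_def)
    obtain D where D: "polynomial_function D" "\<And>x. (R has_derivative (\<lambda>h. D x \<bullet> h)) (at x)"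
      using real_polynomial_function_has_gradient[OF R] by blast
    obtain Q where Q: "polynomial_function Q" "\<And>x. (q2 has_derivative (\<lambda>h. Q x \<bullet> h)) (at x)"
      using real_polynomial_function_has_gradient[OF q(2)] by blast
    \<comment> \<open>The numerator of the derivative over the common denominator \<open>q2 ^ (m + 2)\<close>.\<close>
    define R' where "R' x = (D x \<bullet> e) * q2 x ^ 2 - (D x \<bullet> f) * q1 x * q2 x
        - real m * R x * ((Q x \<bullet> e) * q2 x - (Q x \<bullet> f) * q1 x)" for x
    have pol: "real_polynomial_function (\<lambda>x. D x \<bullet> e)" "real_polynomial_function (\<lambda>x. D x \<bullet> f)"
      "real_polynomial_function (\<lambda>x. Q x \<bullet> e)" "real_polynomial_function (\<lambda>x. Q x \<bullet> f)"
      using D(1) Q(1) by (auto simp: real_polynomial_function_eq)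
    have R': "real_polynomial_function R'"
      unfolding R'_def[abs_def]
      by (intro real_polynomial_function_diff real_polynomial_function_power
          real_polynomial_function.intros(4) pol q R real_polynomial_function.intros(2))
    have "(h has_real_derivative R' (\<gamma> t) / q2 (\<gamma> t) ^ (m + 2)) (at t)" if t: "t \<in> I" for t
    proof -
      define u v a b d where uvabd: "u = q2 (\<gamma> t)" "v = R (\<gamma> t)"
        "a = D (\<gamma> t) \<bullet> e - D (\<gamma> t) \<bullet> f * q1 (\<gamma> t) / q2 (\<gamma> t)"
        "b = Q (\<gamma> t) \<bullet> e - Q (\<gamma> t) \<bullet> f * q1 (\<gamma> t) / q2 (\<gamma> t)" "d = real m * u ^ (m - 1)"
      have u0: "u \<noteq> 0" using nz'[OF t] by (simp add: uvabd)
      have 1: "((\<lambda>t. R (\<gamma> t)) has_real_derivative a) (at t)"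
        using along[OF D(2) t] by (simp add: uvabd)
      have 2: "((\<lambda>t. q2 (\<gamma> t) ^ m) has_real_derivative d * b) (at t)"
        using DERIV_power[OF along[OF Q(2) t], of m] by (simp add: uvabd mult_ac)
      have "(h has_real_derivative (a * u ^ m - v * (d * b)) / (u ^ m * u ^ m)) (at t)"
        unfolding h using DERIV_divide[OF 1 2] u0 by (simp add: uvabd)
      moreover have "(a * u ^ m - v * (d * b)) / (u ^ m * u ^ m) = R' (\<gamma> t) / u ^ (m + 2)"
      proof -
        have du: "d * u = real m * u ^ m"
          by (cases m) (auto simp: uvabd)
        have au: "a * u = (D (\<gamma> t) \<bullet> e) * u - D (\<gamma> t) \<bullet> f * q1 (\<gamma> t)"
          and bu: "b * u = (Q (\<gamma> t) \<bullet> e) * u - Q (\<gamma> t) \<bullet> f * q1 (\<gamma> t)"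
          using u0 unfolding uvabd by (simp_all add: left_diff_distrib)
        have Req: "R' (\<gamma> t) = (a * u) * u - real m * v * (b * u)"
          unfolding R'_def uvabd(1,2)[symmetric] au bu by (simp add: algebra_simps power2_eq_square)
        have "R' (\<gamma> t) * (u ^ m * u ^ m) = (a * u ^ m) * (u ^ m * u\<^sup>2) - v * b * (real m * u ^ m) * (u * u ^ m)"
          unfolding Req by (simp add: algebra_simps power2_eq_square)
        also have "\<dots> = (a * u ^ m - v * (d * b)) * u ^ (m + 2)"
          unfolding du[symmetric] by (simp add: algebra_simps power_add power2_eq_square)
        finally show ?thesis using u0 by (subst frac_eq_eq) simp_all
      qed
      ultimately show ?thesis by (simp add: uvabd)
    qed
    moreover have "(\<lambda>t. R' (\<gamma> t) / q2 (\<gamma> t) ^ (m + 2)) \<in> S"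
      unfolding S_def by (intro CollectI exI[of _ R'] exI[of _ "m + 2"] conjI refl R')
    ultimately show ?thesis
      by (intro bexI[of _ "\<lambda>t. R' (\<gamma> t) / q2 (\<gamma> t) ^ (m + 2)"] ballI)
  qed
  ultimately show ?thesis
    by (rule smooth_real_on_derivative_closed[OF \<open>open I\<close>])
qed

text \<open>The equation \<open>F t y = 0\<close> is solved for \<open>y\<close> near a zero where the second partial derivative is
positive. Monotonicity in \<open>y\<close> yields existence and uniqueness of the solution \<open>g t\<close>, and it shows
that within the box the set \<open>{F > 0}\<close> lies exactly above the graph of \<open>g\<close>. The derivative
is given on the whole interval, so that it can be differentiated again.\<close>

lemma implicit_function_plane:
  fixes F F1 F2 :: "real \<Rightarrow> real \<Rightarrow> real"
  assumes F1: "\<And>t y. ((\<lambda>t. F t y) has_real_derivative F1 t y) (at t)"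
    and F2: "\<And>t y. (F t has_real_derivative F2 t y) (at y)"
    and cont: "continuous_on UNIV (\<lambda>z. F2 (fst z) (snd z))"
    and ab: "F a b = 0" "F2 a b > 0" and "\<delta> > 0"
  obtains r s g where "0 < r" "r < \<delta>" "0 < s" "s < \<delta>"
    and "\<And>t. \<bar>t - a\<bar> < r \<Longrightarrow> \<bar>g t - b\<bar> < s"
    and "\<And>t y. \<bar>t - a\<bar> < r \<Longrightarrow> \<bar>y - b\<bar> < s \<Longrightarrow> 0 < F2 t y"
    and "\<And>t y. \<bar>t - a\<bar> < r \<Longrightarrow> \<bar>y - b\<bar> < s \<Longrightarrow> 0 < F t y \<longleftrightarrow> g t < y"
    and "\<And>t. \<bar>t - a\<bar> < r \<Longrightarrow> (g has_real_derivative - F1 t (g t) / F2 t (g t)) (at t)"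
proof -
  have "open {z. 0 < F2 (fst z) (snd z)}"
    using cont by (intro open_Collect_less) auto
  then obtain d where d: "d > 0" "\<And>z. dist z (a, b) < d \<Longrightarrow> 0 < F2 (fst z) (snd z)"
    using ab(2) unfolding open_dist by force
  define s where "s = min (d / 2) \<delta> / 2"
  have s: "s > 0" "s < \<delta>" "s < d / 2" using \<open>d > 0\<close> \<open>\<delta> > 0\<close> by (auto simp: s_def min_def)
  have pos: "0 < F2 t y" if "\<bar>t - a\<bar> \<le> s" "\<bar>y - b\<bar> \<le> s" for t y
  proof -
    have "dist (t, y) (a, b) \<le> \<bar>t - a\<bar> + \<bar>y - b\<bar>"
      using sqrt_sum_squares_le_sum_abs[of "t - a" "y - b"] by (simp add: dist_Pair_Pair dist_real_def)
    then show ?thesis using d(2)[of "(t, y)"] that s(3) by simp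
  qed
  have mono: "F t y < F t y'" if "\<bar>t - a\<bar> \<le> s" "\<bar>y - b\<bar> \<le> s" "\<bar>y' - b\<bar> \<le> s" "y < y'" for t y y'
  proof (rule DERIV_pos_imp_increasing[OF \<open>y < y'\<close>])
    fix x assume "y \<le> x" "x \<le> y'"
    then have "0 < F2 t x" using that by (intro pos) auto
    then show "\<exists>z. (F t has_real_derivative z) (at x) \<and> 0 < z" using F2 by blast
  qed
  have contF: "isCont (\<lambda>t. F t y) t" for t y using F1 DERIV_isCont by blast
  have "F a (b - s) < 0" "0 < F a (b + s)"
    using mono[of a "b - s" b] mono[of a b "b + s"] s ab by auto
  then have "eventually (\<lambda>t. F t (b - s) < 0) (at a)" "eventually (\<lambda>t. 0 < F t (b + s)) (at a)"
    by (auto intro: order_tendstoD[OF contF[unfolded isCont_def]])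
  then have "eventually (\<lambda>t. F t (b - s) < 0 \<and> 0 < F t (b + s)) (at a)"
    by eventually_elim auto
  then obtain \<rho> where \<rho>: "\<rho> > 0"
    "\<And>t. t \<noteq> a \<Longrightarrow> dist t a < \<rho> \<Longrightarrow> F t (b - s) < 0 \<and> 0 < F t (b + s)"
    unfolding eventually_at by auto
  \<comment> \<open>For \<open>\<bar>t - a\<bar> < r\<close> the function \<open>F t\<close> changes sign between the lower and the upper side of the box.\<close>
  define r where "r = min s \<rho>"
  have r: "r > 0" "r \<le> s" "r \<le> \<rho>" using s \<rho> by (auto simp: r_def)
  have sides: "F t (b - s) < 0" "0 < F t (b + s)" if "\<bar>t - a\<bar> < r" for t
    using \<rho>(2)[of t] that r(3) \<open>F a (b - s) < 0\<close> \<open>0 < F a (b + s)\<close>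
    by (cases "t = a"; force simp: dist_real_def)+
  have "\<exists>y. \<bar>y - b\<bar> < s \<and> F t y = 0" if "\<bar>t - a\<bar> < r" for t
  proof -
    have "\<exists>y\<ge>b - s. y \<le> b + s \<and> F t y = 0"
      using sides[OF that] s F2 by (intro IVT) (auto intro: DERIV_isCont)
    then obtain y where y: "b - s \<le> y" "y \<le> b + s" "F t y = 0" by blast
    then have "y \<noteq> b - s" "y \<noteq> b + s" using sides[OF that] by auto
    with y have "\<bar>y - b\<bar> < s" by auto
    with y(3) show ?thesis by blast
  qed
  then obtain g where g: "\<And>t. \<bar>t - a\<bar> < r \<Longrightarrow> \<bar>g t - b\<bar> < s" "\<And>t. \<bar>t - a\<bar> < r \<Longrightarrow> F t (g t) = 0"
    by metis
  have above: "0 < F t y \<longleftrightarrow> g t < y" if "\<bar>t - a\<bar> < r" "\<bar>y - b\<bar> < s" for t y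
    using mono[of t y "g t"] mono[of t "g t" y] g[OF that(1)] that r(2)
    by (cases y "g t" rule: linorder_cases) auto
  have below: "F t y < 0 \<longleftrightarrow> y < g t" if "\<bar>t - a\<bar> < r" "\<bar>y - b\<bar> < s" for t y
    using mono[of t y "g t"] mono[of t "g t" y] g[OF that(1)] that r(2)
    by (cases y "g t" rule: linorder_cases) auto
  have near: "eventually (\<lambda>x. \<bar>x - a\<bar> < r) (at t)" if "\<bar>t - a\<bar> < r" for t
  proof -
    have "((\<lambda>x. \<bar>x - a\<bar>) \<longlongrightarrow> \<bar>t - a\<bar>) (at t)" by (intro tendsto_intros)
    then show ?thesis by (rule order_tendstoD(2)) (rule that)
  qed
  have gcont: "(g \<longlongrightarrow> g t) (at t)" if t: "\<bar>t - a\<bar> < r" for t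
  proof (rule order_tendstoI)
    fix l assume "l < g t"
    \<comment> \<open>A height below \<open>g t\<close> that is at least \<open>l\<close> and still inside the box.\<close>
    define y where "y = max l ((b - s + g t) / 2)"
    have y: "\<bar>y - b\<bar> < s" "y < g t" "l \<le> y"
      using g(1)[OF t] \<open>l < g t\<close> unfolding y_def by (auto simp: max_def abs_if field_simps split: if_splits)
    then have "F t y < 0" using below[OF t] by blast
    then have "eventually (\<lambda>x. F x y < 0) (at t)"
      by (rule order_tendstoD(2)[OF contF[unfolded isCont_def]])
    with near[OF t] show "eventually (\<lambda>x. l < g x) (at t)"
      by eventually_elim (use below y in force)
  next
    fix u assume "g t < u"
    \<comment> \<open>The corresponding height above \<open>g t\<close>.\<close>
    define y where "y = min u ((b + s + g t) / 2)"
    have y: "\<bar>y - b\<bar> < s" "g t < y" "y \<le> u"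
      using g(1)[OF t] \<open>g t < u\<close> unfolding y_def by (auto simp: min_def abs_if field_simps split: if_splits)
    then have "0 < F t y" using above[OF t] by blast
    then have "eventually (\<lambda>x. 0 < F x y) (at t)"
      by (rule order_tendstoD(1)[OF contF[unfolded isCont_def]])
    with near[OF t] show "eventually (\<lambda>x. g x < u) (at t)"
      by eventually_elim (use above y in force)
  qed
  have gder: "(g has_real_derivative - F1 t (g t) / F2 t (g t)) (at t)" if t: "\<bar>t - a\<bar> < r" for t
  proof -
    \<comment> \<open>By the mean value theorem in the second variable, the difference quotient of \<open>g\<close> at \<open>t\<close> is minus that of \<open>F\<close> in the first variable, divided by \<open>F2 x (\<xi> x)\<close>.\<close>
    have "\<exists>\<xi>. \<bar>\<xi> - g t\<bar> \<le> \<bar>g x - g t\<bar> \<and> \<bar>\<xi> - b\<bar> \<le> s \<and>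
        F x (g t) - F t (g t) = - F2 x \<xi> * (g x - g t)" if x: "\<bar>x - a\<bar> < r" for x
    proof (cases "g x" "g t" rule: linorder_cases)
      case equal
      then show ?thesis using g[OF x] g[OF t] by (intro exI[of _ "g t"]) auto
    next
      case less
      then obtain \<xi> where "g x < \<xi>" "\<xi> < g t" "F x (g t) - F x (g x) = (g t - g x) * F2 x \<xi>"
        using MVT2[OF less, of "F x" "F2 x"] F2 by blast
      then show ?thesis using g[OF x] g[OF t] by (intro exI[of _ \<xi>]) (auto simp: algebra_simps)
    next
      case greater
      then obtain \<xi> where "g t < \<xi>" "\<xi> < g x" "F x (g x) - F x (g t) = (g x - g t) * F2 x \<xi>"
        using MVT2[OF greater, of "F x" "F2 x"] F2 by blast
      then show ?thesis using g[OF x] g[OF t] by (intro exI[of _ \<xi>]) (auto simp: algebra_simps)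
    qed
    then obtain \<xi> where \<xi>: "\<And>x. \<bar>x - a\<bar> < r \<Longrightarrow> \<bar>\<xi> x - g t\<bar> \<le> \<bar>g x - g t\<bar>"
      "\<And>x. \<bar>x - a\<bar> < r \<Longrightarrow> \<bar>\<xi> x - b\<bar> \<le> s"
      "\<And>x. \<bar>x - a\<bar> < r \<Longrightarrow> F x (g t) - F t (g t) = - F2 x (\<xi> x) * (g x - g t)"
      by metis
    have "((\<lambda>x. \<bar>g x - g t\<bar>) \<longlongrightarrow> 0) (at t)"
      using gcont[OF t] tendsto_rabs_zero LIM_zero by blast
    then have "((\<lambda>x. \<xi> x - g t) \<longlongrightarrow> 0) (at t)"
      by (rule Lim_null_comparison[rotated]) (use eventually_mono[OF near[OF t]] \<xi>(1) in force)
    then have "(\<xi> \<longlongrightarrow> g t) (at t)" by (rule LIM_zero_cancel)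
    then have "((\<lambda>x. (x, \<xi> x)) \<longlongrightarrow> (t, g t)) (at t)" by (intro tendsto_intros)
    then have lim2: "((\<lambda>x. F2 x (\<xi> x)) \<longlongrightarrow> F2 t (g t)) (at t)"
      using cont isCont_tendsto_compose[of "(t, g t)" "\<lambda>z. F2 (fst z) (snd z)"]
      by (fastforce simp: continuous_on_eq_continuous_at)
    have lim1: "((\<lambda>x. (F x (g t) - F t (g t)) / (x - t)) \<longlongrightarrow> F1 t (g t)) (at t)"
      using F1[where y = "g t" and t = t] by (simp add: has_field_derivative_iff)
    have "F2 t (g t) \<noteq> 0" using pos[of t "g t"] t g(1)[OF t] r by auto
    then have "((\<lambda>x. - ((F x (g t) - F t (g t)) / (x - t)) / F2 x (\<xi> x)) \<longlongrightarrow>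
        - F1 t (g t) / F2 t (g t)) (at t)"
      by (intro tendsto_intros lim1 lim2)
    moreover have "eventually (\<lambda>x. - ((F x (g t) - F t (g t)) / (x - t)) / F2 x (\<xi> x) =
        (g x - g t) / (x - t)) (at t)"
      using near[OF t]
    proof eventually_elim
      case (elim x)
      have "F2 x (\<xi> x) \<noteq> 0" using pos[of x "\<xi> x"] elim \<xi>(2)[OF elim] r by auto
      then show ?case by (simp add: \<xi>(3)[OF elim])
    qed
    ultimately show ?thesis
      unfolding has_field_derivative_iff by (rule Lim_transform_eventually)
  qed
  show ?thesis
    by (rule that[of r s g]) (use r s g above gder pos in auto)
qed

section \<open>Local structure of a regular zero set\<close>

text \<open>The set is the continuous image of the rectangle \<open>I \<times> J\<close>: the parameter \<open>\<mu>\<close> moves a point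
vertically from the graph of \<open>\<alpha>\<close> to the graph of \<open>\<beta>\<close>.\<close>

lemma connected_vertical_strip:
  fixes e f :: "'a::real_normed_vector" and \<alpha> \<beta> :: "real \<Rightarrow> real"
  assumes I: "convex I" "continuous_on I \<alpha>" "continuous_on I \<beta>"
    and J: "convex J"
  shows "connected {t *\<^sub>R e + ((1 - \<mu>) * \<alpha> t + \<mu> * \<beta> t) *\<^sub>R f | t \<mu>. t \<in> I \<and> \<mu> \<in> J}"
proof -
  have fst: "continuous_on (I \<times> J) (\<lambda>z. \<phi> (fst z))" if "continuous_on I \<phi>" for \<phi> :: "real \<Rightarrow> real"
    by (rule continuous_on_compose2[OF that continuous_on_fst[OF continuous_on_id]]) auto
  have "connected ((\<lambda>z. fst z *\<^sub>R e + ((1 - snd z) * \<alpha> (fst z) + snd z * \<beta> (fst z)) *\<^sub>R f) ` (I \<times> J))"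
    by (intro connected_continuous_image convex_connected convex_Times I J continuous_intros fst)
  moreover have "(\<lambda>z. fst z *\<^sub>R e + ((1 - snd z) * \<alpha> (fst z) + snd z * \<beta> (fst z)) *\<^sub>R f) ` (I \<times> J)
      = {t *\<^sub>R e + ((1 - \<mu>) * \<alpha> t + \<mu> * \<beta> t) *\<^sub>R f | t \<mu>. t \<in> I \<and> \<mu> \<in> J}"
    by (auto simp: image_def)
  ultimately show ?thesis by simp
qed

text \<open>Both regions are vertical strips: the relative height
\<open>(z \<bullet> f - \<alpha>) / (\<beta> - \<alpha>)\<close> ranges over \<open>{0<..<1}\<close> in the first and over \<open>{0<..1}\<close> in the second.\<close>

lemma connected_between_graphs:
  fixes e f :: "'a::real_inner"
  assumes I: "convex I" "continuous_on I \<alpha>" "continuous_on I \<beta>"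
    and less: "\<And>t. t \<in> I \<Longrightarrow> \<alpha> t < \<beta> t"
    and frame: "e \<bullet> e = 1" "f \<bullet> f = 1" "e \<bullet> f = 0" "\<And>x. x = (x \<bullet> e) *\<^sub>R e + (x \<bullet> f) *\<^sub>R f"
  shows "connected {z. z \<bullet> e \<in> I \<and> \<alpha> (z \<bullet> e) < z \<bullet> f \<and> z \<bullet> f < \<beta> (z \<bullet> e)}"
    and "connected {z. z \<bullet> e \<in> I \<and> \<alpha> (z \<bullet> e) < z \<bullet> f \<and> z \<bullet> f \<le> \<beta> (z \<bullet> e)}"
proof -
  have eq: "{z. z \<bullet> e \<in> I \<and> (z \<bullet> f - \<alpha> (z \<bullet> e)) / (\<beta> (z \<bullet> e) - \<alpha> (z \<bullet> e)) \<in> J}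
      = {t *\<^sub>R e + ((1 - \<mu>) * \<alpha> t + \<mu> * \<beta> t) *\<^sub>R f | t \<mu>. t \<in> I \<and> \<mu> \<in> J}"
    (is "?A = ?B") for J
  proof (intro equalityI subsetI)
    fix z assume z: "z \<in> ?A"
    define \<mu> where "\<mu> = (z \<bullet> f - \<alpha> (z \<bullet> e)) / (\<beta> (z \<bullet> e) - \<alpha> (z \<bullet> e))"
    have "\<beta> (z \<bullet> e) - \<alpha> (z \<bullet> e) \<noteq> 0" using less[of "z \<bullet> e"] z by auto
    then have "\<mu> * (\<beta> (z \<bullet> e) - \<alpha> (z \<bullet> e)) = z \<bullet> f - \<alpha> (z \<bullet> e)" by (simp add: \<mu>_def)
    then have "(1 - \<mu>) * \<alpha> (z \<bullet> e) + \<mu> * \<beta> (z \<bullet> e) = z \<bullet> f" by (simp add: algebra_simps)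
    then have "z = (z \<bullet> e) *\<^sub>R e + ((1 - \<mu>) * \<alpha> (z \<bullet> e) + \<mu> * \<beta> (z \<bullet> e)) *\<^sub>R f"
      using frame(4)[of z] by simp
    with z show "z \<in> ?B" unfolding \<mu>_def by blast
  next
    fix z assume "z \<in> ?B"
    then obtain t \<mu> where z: "z = t *\<^sub>R e + ((1 - \<mu>) * \<alpha> t + \<mu> * \<beta> t) *\<^sub>R f" "t \<in> I" "\<mu> \<in> J"
      by blast
    have ze: "z \<bullet> e = t" and zf: "z \<bullet> f - \<alpha> t = \<mu> * (\<beta> t - \<alpha> t)"
      unfolding z(1) inner_add_left inner_scaleR_left frame(1-3) inner_commute[of f e]
      by (simp_all add: algebra_simps)
    show "z \<in> ?A" unfolding mem_Collect_eq ze zf using z(2,3) less[OF z(2)] by simp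
  qed
  have ratio: "0 < (y - \<alpha> t) / (\<beta> t - \<alpha> t) \<longleftrightarrow> \<alpha> t < y" "(y - \<alpha> t) / (\<beta> t - \<alpha> t) < 1 \<longleftrightarrow> y < \<beta> t"
    "(y - \<alpha> t) / (\<beta> t - \<alpha> t) \<le> 1 \<longleftrightarrow> y \<le> \<beta> t" if "t \<in> I" for t y
    using less[OF that] by (simp_all add: zero_less_divide_iff pos_divide_less_eq pos_divide_le_eq)
  have "{z. z \<bullet> e \<in> I \<and> \<alpha> (z \<bullet> e) < z \<bullet> f \<and> z \<bullet> f < \<beta> (z \<bullet> e)} =
      {z. z \<bullet> e \<in> I \<and> (z \<bullet> f - \<alpha> (z \<bullet> e)) / (\<beta> (z \<bullet> e) - \<alpha> (z \<bullet> e)) \<in> {0<..<1}}"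
    using ratio by (intro Collect_cong conj_cong refl) simp
  then show "connected {z. z \<bullet> e \<in> I \<and> \<alpha> (z \<bullet> e) < z \<bullet> f \<and> z \<bullet> f < \<beta> (z \<bullet> e)}"
    unfolding eq by (simp only: connected_vertical_strip[OF I] convex_real_interval)
  have "{z. z \<bullet> e \<in> I \<and> \<alpha> (z \<bullet> e) < z \<bullet> f \<and> z \<bullet> f \<le> \<beta> (z \<bullet> e)} =
      {z. z \<bullet> e \<in> I \<and> (z \<bullet> f - \<alpha> (z \<bullet> e)) / (\<beta> (z \<bullet> e) - \<alpha> (z \<bullet> e)) \<in> {0<..1}}"
    using ratio by (intro Collect_cong conj_cong refl) simp
  then show "connected {z. z \<bullet> e \<in> I \<and> \<alpha> (z \<bullet> e) < z \<bullet> f \<and> z \<bullet> f \<le> \<beta> (z \<bullet> e)}"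
    unfolding eq by (simp only: connected_vertical_strip[OF I] convex_real_interval)
qed

text \<open>Coordinates whose second axis points in the direction of \<open>v\<close>. For a gradient \<open>v\<close> they make the
implicit function theorem applicable in the second coordinate, with the positive side above.\<close>

lemma orthonormal_frame_adapted_to_vector:
  fixes v :: "real^2"
  assumes "v \<noteq> 0"
  obtains A e f where "orthogonal_transformation (A :: real^2 \<Rightarrow> real^2)" "v \<bullet> f > 0"
    "e \<bullet> e = 1" "f \<bullet> f = 1" "e \<bullet> f = 0" "\<And>x. A x $ 1 = x \<bullet> e" "\<And>x. A x $ 2 = x \<bullet> f"
    "\<And>x. x = (x \<bullet> e) *\<^sub>R e + (x \<bullet> f) *\<^sub>R f"
proof -
  define f where "f = v /\<^sub>R norm v"
  have "norm f = norm (axis 2 1 :: real^2)" using assms by (simp add: f_def norm_axis_1)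
  then obtain A :: "real^2 \<Rightarrow> real^2" where A: "orthogonal_transformation A" "A f = axis 2 1"
    using orthogonal_transformation_exists[of f "axis 2 1"] by blast
  obtain e where e: "A e = axis 1 1"
    using orthogonal_transformation_surj[OF A(1)] by (metis surjD)
  have inner: "A x \<bullet> A y = x \<bullet> y" for x y
    using A(1) by (simp add: orthogonal_transformation_def)
  have lin: "linear A" using A(1) by (rule orthogonal_transformation_linear)
  have coord: "A x $ 1 = x \<bullet> e" "A x $ 2 = x \<bullet> f" for x
    using inner[of x e] inner[of x f] by (simp_all add: e A(2) inner_axis)
  show ?thesis
  proof
    show "v \<bullet> f > 0" using assms by (simp add: f_def)
    show "e \<bullet> e = 1" "f \<bullet> f = 1" "e \<bullet> f = 0"
      using inner[of e e] inner[of f f] inner[of e f] by (simp_all add: e A(2) inner_axis_axis)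
    fix x
    have "A x = A ((x \<bullet> e) *\<^sub>R e + (x \<bullet> f) *\<^sub>R f)"
      unfolding linear_add[OF lin] linear_scale[OF lin] e A(2)
      by (simp add: vec_eq_iff forall_2 coord axis_def)
    then show "x = (x \<bullet> e) *\<^sub>R e + (x \<bullet> f) *\<^sub>R f"
      using orthogonal_transformation_inj[OF A(1)] by (auto dest: injD)
  qed (use A(1) coord in auto)
qed

text \<open>The neighbourhood \<open>U\<close> is a rectangle whose sides are parallel and orthogonal to the gradient at \<open>x\<close>.
That the two sides of the curve in \<open>U\<close> are connected is what transfers the description from the set
\<open>{0 < P}\<close> to one of its components, and from there to that component with its holes filled.\<close>

lemma regular_zero_locally_smooth_graph:
  fixes P :: "real^2 \<Rightarrow> real"
  assumes G: "polynomial_function G" and P: "\<And>x. (P has_derivative (\<lambda>h. G x \<bullet> h)) (at x)"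
    and x: "P x = 0" "G x \<noteq> 0" and N: "open N" "x \<in> N"
  obtains U A I g where "open U" "x \<in> U" "U \<subseteq> N" "orthogonal_transformation (A :: real^2 \<Rightarrow> real^2)"
    "open I" "\<And>y. y \<in> U \<Longrightarrow> A y $ 1 \<in> I" "smooth_real_on I g"
    "\<And>y. y \<in> U \<Longrightarrow> 0 < P y \<longleftrightarrow> g (A y $ 1) < A y $ 2"
    "connected {y \<in> U. 0 < P y}" "connected {y \<in> U. \<not> 0 < P y}"
proof -
  obtain A e f where A: "orthogonal_transformation (A :: real^2 \<Rightarrow> real^2)" "G x \<bullet> f > 0"
    and frame: "e \<bullet> e = 1" "f \<bullet> f = 1" "e \<bullet> f = 0" "\<And>x. x = (x \<bullet> e) *\<^sub>R e + (x \<bullet> f) *\<^sub>R f"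
    and Acoord: "\<And>x. A x $ 1 = x \<bullet> e" "\<And>x. A x $ 2 = x \<bullet> f"
    using orthonormal_frame_adapted_to_vector[OF x(2)] by metis
  define a b where "a = x \<bullet> e" and "b = x \<bullet> f"
  define \<gamma> where "\<gamma> t y = t *\<^sub>R e + y *\<^sub>R f" for t y :: real
  have \<gamma>x: "\<gamma> a b = x" using frame(4)[of x] by (simp add: \<gamma>_def a_def b_def)
  have \<gamma>z: "\<gamma> (z \<bullet> e) (z \<bullet> f) = z" for z using frame(4)[of z] by (simp add: \<gamma>_def)
  obtain \<epsilon> where \<epsilon>: "\<epsilon> > 0" "ball x \<epsilon> \<subseteq> N" using N open_contains_ball by blast
  have d1: "((\<lambda>t. P (\<gamma> t y)) has_real_derivative G (\<gamma> t y) \<bullet> e) (at t)" for t y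
  proof (rule has_derivative_imp_has_field_derivative)
    show "((\<lambda>t. P (\<gamma> t y)) has_derivative (\<lambda>h. G (\<gamma> t y) \<bullet> (h *\<^sub>R e))) (at t)"
      by (rule has_derivative_compose[OF _ P]) (auto simp: \<gamma>_def intro!: derivative_eq_intros)
  qed simp
  have d2: "((\<lambda>y. P (\<gamma> t y)) has_real_derivative G (\<gamma> t y) \<bullet> f) (at y)" for t y
  proof (rule has_derivative_imp_has_field_derivative)
    show "((\<lambda>y. P (\<gamma> t y)) has_derivative (\<lambda>h. G (\<gamma> t y) \<bullet> (h *\<^sub>R f))) (at y)"
      by (rule has_derivative_compose[OF _ P]) (auto simp: \<gamma>_def intro!: derivative_eq_intros)
  qed simp
  have "continuous_on UNIV G"
    by (rule differentiable_imp_continuous_on[OF differentiable_on_polynomial_function[OF G]])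
  then have "continuous_on UNIV (\<lambda>z. G (\<gamma> (fst z) (snd z)))"
    by (rule continuous_on_compose2) (auto simp: \<gamma>_def intro!: continuous_intros)
  then have cont: "continuous_on UNIV (\<lambda>z. G (\<gamma> (fst z) (snd z)) \<bullet> f)"
    by (intro continuous_intros)
  have "P (\<gamma> a b) = 0" "0 < G (\<gamma> a b) \<bullet> f" "\<epsilon> / 2 > 0"
    using x(1) A(2) \<epsilon>(1) by (simp_all add: \<gamma>x)
  from implicit_function_plane[OF d1 d2 cont this] obtain r s g
    where rs: "0 < r" "r < \<epsilon> / 2" "0 < s" "s < \<epsilon> / 2"
      and g: "\<And>t. \<bar>t - a\<bar> < r \<Longrightarrow> \<bar>g t - b\<bar> < s"
      and pos: "\<And>t y. \<bar>t - a\<bar> < r \<Longrightarrow> \<bar>y - b\<bar> < s \<Longrightarrow> 0 < G (\<gamma> t y) \<bullet> f"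
      and above: "\<And>t y. \<bar>t - a\<bar> < r \<Longrightarrow> \<bar>y - b\<bar> < s \<Longrightarrow> 0 < P (\<gamma> t y) \<longleftrightarrow> g t < y"
      and dg: "\<And>t. \<bar>t - a\<bar> < r \<Longrightarrow> (g has_real_derivative - (G (\<gamma> t (g t)) \<bullet> e) / (G (\<gamma> t (g t)) \<bullet> f)) (at t)"
    by metis
  define I where "I = {a - r<..<a + r}"
  have I: "t \<in> I \<longleftrightarrow> \<bar>t - a\<bar> < r" for t by (auto simp: I_def)
  define U where "U = {z. \<bar>z \<bullet> e - a\<bar> < r \<and> \<bar>z \<bullet> f - b\<bar> < s}"
  have PU: "0 < P z \<longleftrightarrow> g (z \<bullet> e) < z \<bullet> f" if "z \<in> U" for z
    using above[of "z \<bullet> e" "z \<bullet> f"] that by (simp add: \<gamma>z U_def)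
  have gcont: "continuous_on I g"
    by (intro continuous_at_imp_continuous_on ballI) (use dg I DERIV_isCont in blast)
  have "convex I" by (simp add: I_def)
  note between = connected_between_graphs[OF \<open>convex I\<close> _ _ _ frame]
  show ?thesis
  proof
    show "open U"
      unfolding U_def by (intro open_Collect_conj open_Collect_less continuous_intros)
    show "x \<in> U" using rs by (simp add: U_def a_def b_def)
    show "U \<subseteq> N"
    proof
      fix z assume "z \<in> U"
      have "z - x = (z \<bullet> e - a) *\<^sub>R e + (z \<bullet> f - b) *\<^sub>R f"
        using frame(4)[of "z - x"] by (simp add: inner_diff_left a_def b_def)
      then have "norm (z - x) \<le> norm ((z \<bullet> e - a) *\<^sub>R e) + norm ((z \<bullet> f - b) *\<^sub>R f)"
        by (metis norm_triangle_ineq)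
      also have "\<dots> = \<bar>z \<bullet> e - a\<bar> + \<bar>z \<bullet> f - b\<bar>"
        using frame(1,2) by (simp add: norm_eq_sqrt_inner[of e] norm_eq_sqrt_inner[of f])
      also have "\<dots> < \<epsilon>" using \<open>z \<in> U\<close> rs(2,4) by (simp add: U_def)
      finally show "z \<in> N" using \<epsilon>(2) by (auto simp: dist_norm norm_minus_commute)
    qed
    show "open I" by (simp add: I_def)
    show "smooth_real_on I g"
    proof (rule smooth_implicit_function[OF G \<open>open I\<close> _ _ frame(2,3)])
      fix t assume "t \<in> I"
      then have t: "\<bar>t - a\<bar> < r" by (simp add: I)
      show "(g has_real_derivative - (G (t *\<^sub>R e + g t *\<^sub>R f) \<bullet> e) / (G (t *\<^sub>R e + g t *\<^sub>R f) \<bullet> f)) (at t)"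
        using dg[OF t] by (simp add: \<gamma>_def)
      show "G (t *\<^sub>R e + g t *\<^sub>R f) \<bullet> f \<noteq> 0"
        using pos[OF t g[OF t]] by (simp add: \<gamma>_def)
    qed
    have "{y \<in> U. 0 < P y} = {z. z \<bullet> e \<in> I \<and> g (z \<bullet> e) < z \<bullet> f \<and> z \<bullet> f < b + s}"
    proof (rule Collect_cong)
      show "(z \<in> U \<and> 0 < P z) = (z \<bullet> e \<in> I \<and> g (z \<bullet> e) < z \<bullet> f \<and> z \<bullet> f < b + s)" for z
        using PU[of z] g[of "z \<bullet> e"] unfolding U_def I mem_Collect_eq abs_less_iff by linarith
    qed
    moreover have "g t < b + s" if "t \<in> I" for t using g[of t] that I by auto
    ultimately show "connected {y \<in> U. 0 < P y}"
      using between(1)[OF gcont continuous_on_const] by simp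
    have "{y \<in> U. \<not> 0 < P y} = {z. z \<bullet> e \<in> I \<and> b - s < z \<bullet> f \<and> z \<bullet> f \<le> g (z \<bullet> e)}"
    proof (rule Collect_cong)
      show "(z \<in> U \<and> \<not> 0 < P z) = (z \<bullet> e \<in> I \<and> b - s < z \<bullet> f \<and> z \<bullet> f \<le> g (z \<bullet> e))" for z
        using PU[of z] g[of "z \<bullet> e"] unfolding U_def I mem_Collect_eq abs_less_iff by linarith
    qed
    moreover have "b - s < g t" if "t \<in> I" for t using g[of t] that I by auto
    ultimately show "connected {y \<in> U. \<not> 0 < P y}"
      using between(2)[OF continuous_on_const gcont] by simp
  qed (use A(1) PU in \<open>auto simp: Acoord U_def I\<close>)
qed

section \<open>Connected sets and the components of their complements\<close>

text \<open>Finitely many closed balls inside \<open>\<Omega>\<close> cover \<open>C\<close>; each is joined to a common base point by a path.\<close>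

lemma compact_subset_connected_compact:
  fixes \<Omega> :: "'a::euclidean_space set"
  assumes "open \<Omega>" "connected \<Omega>" "\<Omega> \<noteq> {}" "compact C" "C \<subseteq> \<Omega>"
  obtains L where "compact L" "connected L" "L \<noteq> {}" "C \<subseteq> L" "L \<subseteq> \<Omega>"
proof -
  obtain x0 where x0: "x0 \<in> \<Omega>" using \<open>\<Omega> \<noteq> {}\<close> by blast
  have "\<exists>r>0. cball x r \<subseteq> \<Omega>" if "x \<in> C" for x
    using that \<open>C \<subseteq> \<Omega>\<close> \<open>open \<Omega>\<close> open_contains_cball by blast
  then obtain r where r: "\<And>x. x \<in> C \<Longrightarrow> r x > 0" "\<And>x. x \<in> C \<Longrightarrow> cball x (r x) \<subseteq> \<Omega>"
    by metis
  have "C \<subseteq> (\<Union>x\<in>C. ball x (r x))" using r(1) by force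
  then obtain F where F: "F \<subseteq> C" "finite F" "C \<subseteq> (\<Union>x\<in>F. ball x (r x))"
    using compactE_image[OF \<open>compact C\<close>, of C "\<lambda>x. ball x (r x)"] by blast
  have "\<exists>p. path p \<and> path_image p \<subseteq> \<Omega> \<and> pathstart p = x0 \<and> pathfinish p = x" if "x \<in> C" for x
    using connected_open_path_connected[OF \<open>open \<Omega>\<close> \<open>connected \<Omega>\<close>] x0 that \<open>C \<subseteq> \<Omega>\<close>
    unfolding path_connected_def by blast
  then obtain p where p: "\<And>x. x \<in> C \<Longrightarrow> path (p x)" "\<And>x. x \<in> C \<Longrightarrow> path_image (p x) \<subseteq> \<Omega>"
    "\<And>x. x \<in> C \<Longrightarrow> pathstart (p x) = x0" "\<And>x. x \<in> C \<Longrightarrow> pathfinish (p x) = x"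
    by metis
  define Q where "Q x = path_image (p x) \<union> cball x (r x)" for x
  have Q: "compact (Q x)" "connected (Q x)" "x0 \<in> Q x" "Q x \<subseteq> \<Omega>" if "x \<in> C" for x
  proof -
    have "x \<in> path_image (p x)" "x \<in> cball x (r x)"
      using p(4)[OF that] pathfinish_in_path_image[of "p x"] r(1)[OF that] by auto
    then have "path_image (p x) \<inter> cball x (r x) \<noteq> {}" by blast
    then show "connected (Q x)"
      unfolding Q_def by (intro connected_Un connected_path_image p(1) that connected_cball)
    show "compact (Q x)"
      unfolding Q_def by (intro compact_Un compact_path_image p(1) that compact_cball)
    show "x0 \<in> Q x"
      unfolding Q_def using p(3)[OF that] pathstart_in_path_image[of "p x"] by auto
    show "Q x \<subseteq> \<Omega>"
      unfolding Q_def using p(2) r(2) that by auto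
  qed
  show ?thesis
  proof
    let ?L = "insert x0 (\<Union>x\<in>F. Q x)"
    show "compact ?L"
      using F Q(1) by (intro compact_insert compact_UN) auto
    have "connected (\<Union>(insert {x0} (Q ` F)))"
      by (rule connected_Union) (use F Q in auto)
    then show "connected ?L" by simp
    show "C \<subseteq> ?L"
      using F(3) ball_subset_cball unfolding Q_def by blast
    show "?L \<subseteq> \<Omega>"
      using Q(4) F(1) x0 by auto
  qed auto
qed

text \<open>Sending a component of \<open>K\<close> to the component of \<open>B\<close> around it is surjective.\<close>

lemma components_card_le_if_each_meets:
  assumes "K \<subseteq> B" "finite (components K)"
    and meets: "\<And>X. X \<in> components B \<Longrightarrow> X \<inter> K \<noteq> {}"
  shows "finite (components B)" "card (components B) \<le> card (components K)"
proof -
  have "\<exists>X\<in>components B. A \<subseteq> X" if "A \<in> components K" for A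
    using exists_component_superset[of A B] that in_components_connected in_components_nonempty
      in_components_subset \<open>K \<subseteq> B\<close> by (metis subset_empty order_trans)
  then obtain h where h: "\<And>A. A \<in> components K \<Longrightarrow> h A \<in> components B"
    "\<And>A. A \<in> components K \<Longrightarrow> A \<subseteq> h A" by metis
  have "components B \<subseteq> h ` components K"
  proof
    fix X assume X: "X \<in> components B"
    then obtain x where x: "x \<in> X" "x \<in> K" using meets by blast
    then obtain A where A: "A \<in> components K" "x \<in> A"
      using Union_components[of K] by blast
    then have "h A = X"
      using components_nonoverlap[OF h(1)[OF A(1)] X] h(2)[OF A(1)] x(1) by blast
    with A(1) show "X \<in> h ` components K" by blast
  qed
  then show "finite (components B)" "card (components B) \<le> card (components K)"
    using assms(2) by (auto intro: finite_surj surj_card_le)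
qed

text \<open>Components of \<open>E - V\<close> that meet \<open>E - \<Omega>\<close> are kept as complement (their union is \<open>B\<close>), and the other
ones, the holes of \<open>V\<close> inside \<open>\<Omega>\<close>, are added to \<open>V\<close>. There are only finitely many of the former,
since each contains a component of \<open>E - \<Omega>\<close>; so \<open>B\<close> is closed and the new set is open, however many
holes there are. The last conclusion says that filling leaves a set \<open>U\<close> alone if its part outside
\<open>V\<close> is connected and contains a point that is not filled.\<close>

lemma hole_filling:
  fixes E V \<Omega> :: "'a::euclidean_space set"
  assumes E: "compact E" "closure \<Omega> \<subseteq> E" and "open \<Omega>"
    and V: "open V" "connected V" "V \<noteq> {}" "closure V \<subseteq> \<Omega>"
    and K: "finite (components (E - \<Omega>))" "frontier E \<inter> \<Omega> = {}"
  obtains V' where "V \<subseteq> V'" "V' \<subseteq> \<Omega>" "open V'" "connected V'" "closure V' \<subseteq> \<Omega>"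
    "finite (components (E - V'))" "card (components (E - V')) \<le> card (components (E - \<Omega>))"
    "frontier V' \<subseteq> frontier V"
    "\<And>U. U \<subseteq> \<Omega> \<Longrightarrow> connected (U - V) \<Longrightarrow> \<not> U - V \<subseteq> V' \<Longrightarrow> U \<inter> V' = U \<inter> V"
proof -
  let ?K = "E - \<Omega>"
  have V_sub: "V \<subseteq> \<Omega>" using V(4) closure_subset by blast
  define outer where "outer = {X \<in> components (E - V). X \<inter> ?K \<noteq> {}}"
  define B where "B = \<Union>outer"
  define V' where "V' = E - B"
  have "\<Omega> \<subseteq> E" using E(2) closure_subset by blast
  have closedEV: "closed (E - V)"
    using E(1) V(1) by (intro closed_Diff compact_imp_closed)
  have KEV: "?K \<subseteq> E - V" using V_sub by blast
  have outer_superset: "\<exists>X\<in>outer. S \<subseteq> X" if S: "connected S" "S \<subseteq> E - V" "S \<inter> ?K \<noteq> {}" for S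
  proof -
    obtain X where "X \<in> components (E - V)" "S \<subseteq> X"
      using exists_component_superset[of S "E - V"] S by blast
    with S(3) show ?thesis unfolding outer_def by blast
  qed
  have KB: "?K \<subseteq> B"
  proof
    fix x assume "x \<in> ?K"
    then show "x \<in> B"
      using outer_superset[of "{x}"] KEV unfolding B_def by auto
  qed
  have B_sub: "B \<subseteq> E - V"
    unfolding B_def outer_def using in_components_subset by blast
  have filled: "\<exists>X. X \<in> components (E - V) \<and> X \<inter> ?K = {} \<and> x \<in> X \<and> X \<subseteq> V'" if "x \<in> V'" "x \<notin> V" for x
  proof -
    have "x \<in> E - V" using that unfolding V'_def by blast
    then obtain X where X: "X \<in> components (E - V)" "x \<in> X"
      using Union_components[of "E - V"] by blast
    then have "X \<notin> outer" using that unfolding V'_def B_def by blast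
    then have "X \<inter> ?K = {}" using X unfolding outer_def by blast
    have "X \<inter> Y = {}" if "Y \<in> outer" for Y
      using components_nonoverlap[OF X(1), of Y] that \<open>X \<notin> outer\<close> unfolding outer_def by blast
    then have "X \<inter> B = {}" unfolding B_def by blast
    then have "X \<subseteq> V'" using in_components_subset[OF X(1)] unfolding V'_def by blast
    with X \<open>X \<inter> ?K = {}\<close> show ?thesis by blast
  qed
  have VV': "V \<subseteq> V'" using B_sub V_sub \<open>\<Omega> \<subseteq> E\<close> unfolding V'_def by blast
  have V'\<Omega>: "V' \<subseteq> \<Omega>" using KB unfolding V'_def by blast
  have "finite outer"
  proof -
    have "\<exists>A\<in>components ?K. A \<subseteq> X" if X: "X \<in> outer" for X
    proof -
      obtain x where x: "x \<in> X" "x \<in> ?K" using X unfolding outer_def by blast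
      then obtain A where A: "A \<in> components ?K" "x \<in> A" using Union_components[of ?K] by blast
      have "A \<subseteq> X"
        using components_maximal[of X "E - V" A] A x X in_components_connected[OF A(1)]
          in_components_subset[OF A(1)] KEV unfolding outer_def by blast
      with A show ?thesis by blast
    qed
    then obtain c where c: "\<And>X. X \<in> outer \<Longrightarrow> c X \<in> components ?K" "\<And>X. X \<in> outer \<Longrightarrow> c X \<subseteq> X"
      by metis
    have "inj_on c outer"
    proof (rule inj_onI)
      fix X Y assume XY: "X \<in> outer" "Y \<in> outer" "c X = c Y"
      have "c X \<noteq> {}" using c(1)[OF XY(1)] in_components_nonempty by blast
      then have "X \<inter> Y \<noteq> {}" using c(2)[OF XY(1)] c(2)[OF XY(2)] XY(3) by blast
      then show "X = Y" using XY components_nonoverlap unfolding outer_def by blast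
    qed
    then show ?thesis
      using K(1) c(1) by (meson finite_imageD finite_subset image_subsetI)
  qed
  then have "closed B"
    unfolding B_def
    by (rule closed_Union) (use closed_components[OF closedEV] outer_def in blast)
  have V'_eq: "V' = interior E - B"
  proof -
    have "\<Omega> \<subseteq> interior E"
      using K(2) \<open>\<Omega> \<subseteq> E\<close> closure_subset[of E] unfolding frontier_def by blast
    then show ?thesis
      using V'\<Omega> interior_subset[of E] unfolding V'_def by blast
  qed
  have "open V'"
    unfolding V'_eq using \<open>closed B\<close> by (intro open_Diff) auto
  \<comment> \<open>A filled component lies in \<open>\<Omega>\<close>; if it stayed away from \<open>closure V\<close>, it would be open, closed and bounded.\<close>
  have touches: "X \<inter> closure V \<noteq> {}" if X: "X \<in> components (E - V)" "X \<inter> ?K = {}" for X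
  proof
    assume disj: "X \<inter> closure V = {}"
    have "X \<subseteq> E - V" "X \<noteq> {}" using X in_components_subset in_components_nonempty by blast+
    then have "X \<subseteq> \<Omega>" using X(2) by blast
    have "open X"
      unfolding open_contains_ball
    proof
      fix x assume "x \<in> X"
      then have "x \<in> \<Omega> - closure V" using disj \<open>X \<subseteq> \<Omega>\<close> by blast
      moreover have "open (\<Omega> - closure V)" using \<open>open \<Omega>\<close> by (intro open_Diff) auto
      ultimately obtain e where e: "e > 0" "ball x e \<subseteq> \<Omega> - closure V"
        using open_contains_ball by metis
      then have "ball x e \<subseteq> E - V" using \<open>\<Omega> \<subseteq> E\<close> closure_subset[of V] by blast
      moreover have "X \<inter> ball x e \<noteq> {}" using \<open>x \<in> X\<close> \<open>e > 0\<close> by auto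
      ultimately have "ball x e \<subseteq> X"
        using components_maximal[OF X(1)] by blast
      with e(1) show "\<exists>e>0. ball x e \<subseteq> X" by blast
    qed
    moreover have "closed X" using closed_components[OF closedEV X(1)] .
    ultimately have "X = UNIV" using clopen[of X] \<open>X \<noteq> {}\<close> by blast
    then have "E = UNIV" using \<open>X \<subseteq> E - V\<close> by blast
    then show False using E(1) not_compact_UNIV by simp
  qed
  have "connected V'"
  proof -
    define fills where "fills = {X \<in> components (E - V). X \<inter> ?K = {} \<and> X \<subseteq> V'}"
    have fill: "connected (V \<union> X)" if "X \<in> fills" for X
    proof -
      have X: "X \<in> components (E - V)" "X \<inter> ?K = {}" using that unfolding fills_def by auto
      have "connected (V \<union> (X \<inter> closure V))"
        by (rule connected_intermediate_closure[OF V(2)]) (use closure_subset in auto)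
      then have "connected ((V \<union> (X \<inter> closure V)) \<union> X)"
        by (rule connected_Un[OF _ in_components_connected[OF X(1)]]) (use touches[OF X] in blast)
      moreover have "(V \<union> (X \<inter> closure V)) \<union> X = V \<union> X" by blast
      ultimately show ?thesis by simp
    qed
    have "V' = \<Union>(insert V ((\<lambda>X. V \<union> X) ` fills))"
      using filled VV' unfolding fills_def by (auto; blast)
    moreover have "connected (\<Union>(insert V ((\<lambda>X. V \<union> X) ` fills)))"
    proof (rule connected_Union)
      show "\<Inter>(insert V ((\<lambda>X. V \<union> X) ` fills)) \<noteq> {}" using V(3) by auto
      fix s assume "s \<in> insert V ((\<lambda>X. V \<union> X) ` fills)"
      then consider "s = V" | X where "X \<in> fills" "s = V \<union> X" by blast
      then show "connected s"
        by cases (simp_all add: V(2) fill)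
    qed
    ultimately show ?thesis by simp
  qed
  \<comment> \<open>Near a point outside \<open>closure V\<close>, a segment starting in a filled component cannot leave that component: on leaving \<open>\<Omega>\<close> it would connect the component to \<open>E - \<Omega>\<close>.\<close>
  have front: "closure V' - V' \<subseteq> closure V"
  proof
    fix x assume x: "x \<in> closure V' - V'"
    show "x \<in> closure V"
    proof (rule ccontr)
      assume "x \<notin> closure V"
      then obtain e where e: "e > 0" "ball x e \<subseteq> - closure V"
        using open_contains_ball[of "- closure V"] by auto
      obtain y where y: "y \<in> V'" "y \<in> ball x e"
        using x e(1) closure_approachable[of x V'] by (auto simp: dist_commute)
      then have "y \<notin> V" using e(2) closure_subset[of V] by blast
      then obtain X where X: "X \<in> components (E - V)" "X \<inter> ?K = {}" "y \<in> X" "X \<subseteq> V'"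
        using filled y(1) by blast
      have seg: "closed_segment y z \<subseteq> E - V" if z: "z \<in> closed_segment y x" "closed_segment y z \<subseteq> E" for z
      proof -
        have "closed_segment y z \<subseteq> ball x e"
          using closed_segment_subset[OF y(2) _ convex_ball, of x] z(1) e(1) y(2)
          by (intro closed_segment_subset convex_ball) auto
        then show ?thesis using e(2) closure_subset[of V] z(2) by blast
      qed
      show False
      proof (cases "closed_segment y x \<subseteq> \<Omega>")
        case True
        then have "closed_segment y x \<subseteq> X"
          using components_maximal[OF X(1) connected_segment(1) seg[of x]] X(3) \<open>\<Omega> \<subseteq> E\<close>
            ends_in_segment[of y x] by blast
        then show False using X(4) x by auto
      next
        case False
        have "closed (closed_segment y x - \<Omega>)" "closed_segment y x - \<Omega> \<noteq> {}"
          using False \<open>open \<Omega>\<close> by (auto intro!: closed_Diff closed_segment)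
        \<comment> \<open>The first point at which the segment from \<open>y\<close> to \<open>x\<close> leaves \<open>\<Omega>\<close>; up to there it stays in \<open>E\<close>.\<close>
        then obtain z where z0: "z \<in> closed_segment y x - \<Omega>"
          and z1: "\<And>w. w \<in> closed_segment y x - \<Omega> \<Longrightarrow> dist y z \<le> dist y w"
          by (rule distance_attains_inf[where a = y]) (rule that)
        from z0 z1 have z: "z \<in> closed_segment y x" "z \<notin> \<Omega>"
          "\<And>w. w \<in> closed_segment y x \<Longrightarrow> w \<notin> \<Omega> \<Longrightarrow> dist y z \<le> dist y w"
          by auto
        have "open_segment y z \<subseteq> \<Omega>"
        proof
          fix w assume w: "w \<in> open_segment y z"
          then have "dist y w < dist y z"
            using open_segment_bound1[OF w] by (simp add: dist_norm norm_minus_commute)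
          moreover have "w \<in> closed_segment y x"
            using w z(1) subset_closed_segment[of y z y x] segment_open_subset_closed[of y z] by auto
          ultimately show "w \<in> \<Omega>" using z(3)[of w] by (meson not_less)
        qed
        moreover have "y \<noteq> z" using y(1) V'\<Omega> z(2) by blast
        ultimately have "closed_segment y z \<subseteq> closure \<Omega>"
          using closure_mono[of "open_segment y z" \<Omega>] by (simp add: closure_open_segment)
        then have yz: "closed_segment y z \<subseteq> E" using E(2) by blast
        have "closed_segment y z \<subseteq> X"
          using components_maximal[OF X(1) connected_segment(1) seg[OF z(1) yz]] X(3)
            ends_in_segment[of y z] by blast
        then have "z \<in> X" by auto
        moreover have "z \<in> ?K" using z(2) yz by auto
        ultimately show False using X(2) by blast
      qed
    qed
  qed
  have EV': "E - V' = B" using B_sub unfolding V'_def by blast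
  have meets: "X \<inter> ?K \<noteq> {}" if X: "X \<in> components B" for X
  proof -
    obtain x where "x \<in> X" using in_components_nonempty[OF X] by blast
    then have "x \<in> B" using in_components_subset[OF X] by blast
    then obtain Y where Y: "Y \<in> outer" "x \<in> Y" unfolding B_def by blast
    have "connected Y" using Y(1) in_components_connected unfolding outer_def by blast
    moreover have "Y \<subseteq> B" using Y(1) unfolding B_def by blast
    ultimately have "Y \<subseteq> X"
      using components_maximal[OF X] \<open>x \<in> X\<close> Y(2) by blast
    with Y(1) show ?thesis unfolding outer_def by blast
  qed
  have frontier_sub: "frontier V' \<subseteq> frontier V"
  proof
    fix x assume "x \<in> frontier V'"
    then have "x \<in> closure V' - V'" using \<open>open V'\<close> by (simp add: frontier_def interior_open)
    then show "x \<in> frontier V"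
      using front VV' V(1) by (auto simp: frontier_def interior_open)
  qed
  have localV: "U \<inter> V' = U \<inter> V" if U: "U \<subseteq> \<Omega>" "connected (U - V)" "\<not> U - V \<subseteq> V'" for U
  proof -
    obtain x where x: "x \<in> U - V" "x \<notin> V'" using U(3) by blast
    then have "x \<in> B" using U(1) \<open>\<Omega> \<subseteq> E\<close> unfolding V'_def by blast
    then obtain Y where Y: "Y \<in> outer" "x \<in> Y" unfolding B_def by blast
    then have "Y \<in> components (E - V)" unfolding outer_def by blast
    then have "U - V \<subseteq> Y"
      using components_maximal[OF _ U(2)] x(1) Y(2) U(1) \<open>\<Omega> \<subseteq> E\<close> by blast
    then have "U - V \<subseteq> B" using Y(1) unfolding B_def by blast
    then show ?thesis using VV' unfolding V'_def by blast
  qed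
  show ?thesis
  proof (rule that[OF VV' V'\<Omega> \<open>open V'\<close> \<open>connected V'\<close> _ _ _ frontier_sub localV])
    show "closure V' \<subseteq> \<Omega>" using front V'\<Omega> V(4) by blast
    show "finite (components (E - V'))" "card (components (E - V')) \<le> card (components ?K)"
      unfolding EV' using components_card_le_if_each_meets[OF KB K(1) meets] by blast+
  qed
qed

section \<open>Approximation from inside by smooth domains\<close>

lemma hausdorff_distance_superset_le:
  assumes "A \<noteq> {}" "A \<subseteq> B" "\<And>b. b \<in> B \<Longrightarrow> infdist b A \<le> \<epsilon>" "0 \<le> \<epsilon>"
  shows "hausdorff_distance B A \<le> \<epsilon>"
proof -
  have "(SUP b\<in>B. infdist b A) \<le> \<epsilon>"
    using assms by (intro cSUP_least) auto
  moreover have "(SUP a\<in>A. infdist a B) \<le> \<epsilon>"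
    using assms by (intro cSUP_least) (auto simp: subset_eq)
  ultimately show ?thesis by (simp add: hausdorff_distance_def)
qed

text \<open>Both parts of the theorem rest on this: the approximating set is nonempty, so it belongs to
\<open>C_class l D\<close> whenever \<open>\<Omega>\<close> does, which gives the density statement.\<close>

lemma smooth_domain_inner_approximation:
  fixes D \<Omega> :: "(real^2) set"
  assumes D: "D \<noteq> {}" "open D" "bounded D"
    and \<Omega>: "\<Omega> \<noteq> {}" "open \<Omega>" "connected \<Omega>" "\<Omega> \<subseteq> D"
    and fin: "finite (components (closure D - \<Omega>))" and "\<epsilon> > 0"
  obtains V where "V \<noteq> {}" "connected V" "open V" "smooth_boundary V" "V \<Subset> \<Omega>"
    "finite (components (closure D - V))"
    "card (components (closure D - V)) \<le> card (components (closure D - \<Omega>))"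
    "\<Omega> - V \<subseteq> {x \<in> \<Omega>. infdist x (frontier \<Omega>) < \<epsilon>}"
    "complementary_hausdorff_distance D V \<Omega> \<le> \<epsilon>"
proof -
  let ?K = "closure D - \<Omega>"
  have "compact (closure D)" using D(3) by (simp add: compact_closure)
  then have compK: "compact ?K" using \<Omega>(2) by (rule compact_diff)
  have cl: "closure \<Omega> \<subseteq> closure D" using \<Omega>(4) by (rule closure_mono)
  have "bounded \<Omega>" using D(3) \<Omega>(4) bounded_subset by blast
  have front_sub: "frontier \<Omega> \<subseteq> ?K"
    using cl \<Omega>(2) by (auto simp: frontier_def interior_open)
  have "\<Omega> \<noteq> UNIV" using \<open>bounded \<Omega>\<close> not_bounded_UNIV by auto
  then have front_ne: "frontier \<Omega> \<noteq> {}" using \<Omega>(1) frontier_eq_empty by blast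
  \<comment> \<open>Taking the closure of \<open>\<Omega>\<close> makes \<open>C\<close> visibly closed; its points still lie in \<open>\<Omega>\<close>, as their distance to the frontier is positive.\<close>
  define C where "C = {x \<in> closure \<Omega>. \<epsilon> \<le> infdist x (frontier \<Omega>)}"
  have "closed C"
    unfolding C_def by (intro closed_Collect_conj closed_Collect_le continuous_intros) auto
  then have "compact C"
    using \<open>bounded \<Omega>\<close> by (auto simp: compact_eq_bounded_closed C_def intro: bounded_subset[OF bounded_closure])
  have "C \<subseteq> \<Omega>"
  proof
    fix x assume "x \<in> C"
    then have "x \<notin> frontier \<Omega>" using \<open>\<epsilon> > 0\<close> by (auto simp: C_def)
    with \<open>x \<in> C\<close> show "x \<in> \<Omega>"
      using \<Omega>(2) by (auto simp: C_def frontier_def interior_open)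
  qed
  obtain L where L: "compact L" "connected L" "L \<noteq> {}" "C \<subseteq> L" "L \<subseteq> \<Omega>"
    using compact_subset_connected_compact[OF \<Omega>(2,3,1) \<open>compact C\<close> \<open>C \<subseteq> \<Omega>\<close>] by metis
  have "?K \<inter> L = {}" using L(5) by blast
  obtain P G where P: "real_polynomial_function P" and G: "polynomial_function G"
    and PG: "\<And>x. (P has_derivative (\<lambda>h. G x \<bullet> h)) (at x)"
    and PK: "\<And>x. x \<in> ?K \<Longrightarrow> P x < 0" and PL: "\<And>x. x \<in> L \<Longrightarrow> P x > 0"
    and reg: "\<And>x. P x = 0 \<Longrightarrow> G x \<noteq> 0"
    using regular_polynomial_separating_compact_sets[OF compK L(1) \<open>?K \<inter> L = {}\<close>] by metis
  have contP: "continuous_on UNIV P"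
    using PG has_derivative_continuous continuous_at_imp_continuous_on by blast
  define W where "W = {x \<in> \<Omega>. 0 < P x}"
  have "open W"
  proof -
    have "W = \<Omega> \<inter> {x. 0 < P x}" by (auto simp: W_def)
    then show ?thesis using \<Omega>(2) contP by (simp add: open_Int open_Collect_less)
  qed
  have clW: "closure W \<subseteq> {x \<in> \<Omega>. 0 \<le> P x}"
  proof -
    have "closed {x. 0 \<le> P x}" using contP by (simp add: closed_Collect_le)
    then have "closure W \<subseteq> {x. 0 \<le> P x}" by (intro closure_minimal) (auto simp: W_def)
    moreover have "closure W \<subseteq> closure D"
      using closure_mono[of W \<Omega>] cl by (auto simp: W_def)
    ultimately show ?thesis using PK by force
  qed
  have "L \<subseteq> W" using L(5) PL by (auto simp: W_def)
  then obtain V where V: "V \<in> components W" "L \<subseteq> V"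
    using exists_component_superset[of L W] L(2,3) by blast
  have "V \<subseteq> W" using in_components_subset[OF V(1)] .
  have Vprops: "open V" "connected V" "V \<noteq> {}"
    using open_components[OF \<open>open W\<close> V(1)] in_components_connected[OF V(1)] in_components_nonempty[OF V(1)]
    by blast+
  have "closure V \<subseteq> \<Omega>"
    using clW closure_mono[OF \<open>V \<subseteq> W\<close>] by blast
  have zero: "P x = 0" "x \<in> \<Omega>" "x \<in> closure V" if "x \<in> frontier V" for x
  proof -
    have x: "x \<in> closure V" "x \<notin> V" using that Vprops(1) by (auto simp: frontier_def interior_open)
    then have x': "x \<in> \<Omega>" "0 \<le> P x" using clW closure_mono[OF \<open>V \<subseteq> W\<close>] by auto
    \<comment> \<open>Otherwise \<open>x\<close> would lie in \<open>W\<close>, in a component that is open and meets \<open>V\<close>, hence in \<open>V\<close>.\<close>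
    have "\<not> 0 < P x"
    proof
      assume "0 < P x"
      then have "x \<in> W" using x' by (simp add: W_def)
      then obtain V2 where V2: "V2 \<in> components W" "x \<in> V2" using Union_components[of W] by blast
      have "V2 \<inter> V \<noteq> {}"
        using x(1) V2(2) open_components[OF \<open>open W\<close> V2(1)]
        by (metis IntI Int_commute closure_iff_nhds_not_empty empty_iff inf.idem order_refl open_Int_closure_eq_empty)
      then have "V2 = V" using components_nonoverlap[OF V2(1) V(1)] by blast
      then show False using V2(2) x(2) by blast
    qed
    then show "P x = 0" "x \<in> \<Omega>" "x \<in> closure V" using x x' by auto
  qed
  have "frontier (closure D) \<inter> \<Omega> = {}"
    using \<Omega>(4) D(2) interior_maximal[OF closure_subset D(2)] by (auto simp: frontier_def)
  then obtain V' where V': "V \<subseteq> V'" "V' \<subseteq> \<Omega>" "open V'" "connected V'" "closure V' \<subseteq> \<Omega>"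
    and comps: "finite (components (closure D - V'))"
      "card (components (closure D - V')) \<le> card (components ?K)"
    and frV': "frontier V' \<subseteq> frontier V"
    and localV: "\<And>U. U \<subseteq> \<Omega> \<Longrightarrow> connected (U - V) \<Longrightarrow> \<not> U - V \<subseteq> V' \<Longrightarrow> U \<inter> V' = U \<inter> V"
    using hole_filling[OF \<open>compact (closure D)\<close> cl \<Omega>(2) Vprops \<open>closure V \<subseteq> \<Omega>\<close> fin]
    by metis
  have "smooth_boundary V'"
    unfolding smooth_boundary_def
  proof
    fix x assume xV': "x \<in> frontier V'"
    then have xV: "x \<in> frontier V" using frV' by blast
    have "x \<notin> V'" using xV' V'(3) by (auto simp: frontier_def interior_open)
    obtain U A I g where U: "open U" "x \<in> U" "U \<subseteq> \<Omega>" "orthogonal_transformation (A :: real^2 \<Rightarrow> real^2)"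
      "open I" "\<And>y. y \<in> U \<Longrightarrow> A y $ 1 \<in> I" "smooth_real_on I g"
      and Ug: "\<And>y. y \<in> U \<Longrightarrow> 0 < P y \<longleftrightarrow> g (A y $ 1) < A y $ 2"
      and Uconn: "connected {y \<in> U. 0 < P y}" "connected {y \<in> U. \<not> 0 < P y}"
      by (rule regular_zero_locally_smooth_graph[OF G PG zero(1)[OF xV] reg[OF zero(1)[OF xV]] \<Omega>(2) zero(2)[OF xV]])
        (rule that)
    have "U \<inter> V \<noteq> {}"
      using zero(3)[OF xV] U(1,2) by (metis IntI empty_iff open_Int_closure_eq_empty)
    moreover have UW: "{y \<in> U. 0 < P y} \<subseteq> W" using U(3) by (auto simp: W_def)
    ultimately have "{y \<in> U. 0 < P y} \<subseteq> V"
      using \<open>V \<subseteq> W\<close> by (intro components_maximal[OF V(1) Uconn(1) UW]) (auto simp: W_def)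
    then have UV: "U \<inter> V = {y \<in> U. 0 < P y}" "U - V = {y \<in> U. \<not> 0 < P y}"
      using \<open>V \<subseteq> W\<close> by (auto simp: W_def)
    \<comment> \<open>The point \<open>x\<close> itself belongs to \<open>U - V\<close> and is not filled.\<close>
    have "U \<inter> V' = U \<inter> V"
    proof (rule localV[OF U(3)])
      show "connected (U - V)" unfolding UV using Uconn(2) .
      show "\<not> U - V \<subseteq> V'" using U(2) \<open>x \<notin> V'\<close> V'(1) by blast
    qed
    then have "V' \<inter> U = {y \<in> U. g (A y $ 1) < A y $ 2}"
      using UV(1) Ug by blast
    then show "\<exists>U A I g. open U \<and> x \<in> U \<and> orthogonal_transformation (A :: real^2 \<Rightarrow> real^2) \<and>
        open I \<and> (\<forall>y\<in>U. A y $ 1 \<in> I) \<and> smooth_real_on I g \<and> V' \<inter> U = {y \<in> U. g (A y $ 1) < A y $ 2}"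
      using U by (intro exI[of _ U] exI[of _ A] exI[of _ I] exI[of _ g]) simp
  qed
  have near: "\<Omega> - V' \<subseteq> {x \<in> \<Omega>. infdist x (frontier \<Omega>) < \<epsilon>}"
  proof
    fix x assume x: "x \<in> \<Omega> - V'"
    then have "x \<notin> C" using L(4) V(2) V'(1) by blast
    with x show "x \<in> {x \<in> \<Omega>. infdist x (frontier \<Omega>) < \<epsilon>}"
      using closure_subset[of \<Omega>] by (auto simp: C_def)
  qed
  have "infdist b ?K \<le> \<epsilon>" if b: "b \<in> closure D - V'" for b
  proof (cases "b \<in> \<Omega>")
    case True
    then have "infdist b (frontier \<Omega>) < \<epsilon>" using near b by auto
    then show ?thesis using infdist_mono[OF front_sub front_ne, of b] by linarith
  next
    case False
    then show ?thesis using b \<open>\<epsilon> > 0\<close> by simp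
  qed
  then have "complementary_hausdorff_distance D V' \<Omega> \<le> \<epsilon>"
    unfolding complementary_hausdorff_distance_def
    using front_sub front_ne V'(2) \<open>\<epsilon> > 0\<close> by (intro hausdorff_distance_superset_le) auto
  moreover have "V' \<Subset> \<Omega>"
    unfolding compactly_contained_def
    using V'(2,5) \<open>bounded \<Omega>\<close> bounded_subset by (auto simp: compact_closure)
  ultimately show ?thesis
    using that[of V'] V'(1,3,4) Vprops(3) \<open>smooth_boundary V'\<close> comps near by blast
qed

theorem proposition2p4:
  fixes D \<Omega> :: "(real^2) set" and l :: nat
  assumes "is_domain D" and "bounded D" and "l \<ge> 1" and "\<Omega> \<in> C_class l D"
  shows "(\<exists>\<epsilon>\<^sub>0>0. \<forall>\<epsilon>::real. 0 < \<epsilon> \<and> \<epsilon> < \<epsilon>\<^sub>0 \<longrightarrow>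
            (\<exists>\<Omega>\<^sub>\<epsilon>. connected \<Omega>\<^sub>\<epsilon> \<and> open \<Omega>\<^sub>\<epsilon> \<and> smooth_boundary \<Omega>\<^sub>\<epsilon> \<and>
               \<Omega>\<^sub>\<epsilon> \<Subset> \<Omega> \<and>
               finite (components (closure D - \<Omega>\<^sub>\<epsilon>)) \<and>
               card (components (closure D - \<Omega>\<^sub>\<epsilon>)) \<le> card (components (closure D - \<Omega>)) \<and>
               \<Omega> - \<Omega>\<^sub>\<epsilon> \<subseteq> {x \<in> \<Omega>. infdist x (frontier \<Omega>) < \<epsilon>} \<and>
               complementary_hausdorff_distance D \<Omega>\<^sub>\<epsilon> \<Omega> \<le> \<epsilon>))
       \<and> (\<forall>\<Omega>'\<in>C_class l D. \<forall>\<delta>::real. 0 < \<delta> \<longrightarrow>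
            (\<exists>\<Omega>''\<in>C_class l D. smooth_boundary \<Omega>'' \<and>
               complementary_hausdorff_distance D \<Omega>'' \<Omega>' < \<delta>))"
proof -
  have D: "D \<noteq> {}" "open D" "bounded D" using assms(1,2) by (auto simp: is_domain_def)
  have cls: "W \<noteq> {}" "open W" "connected W" "W \<subseteq> D" "finite (components (closure D - W))"
    "card (components (closure D - W)) \<le> l" if "W \<in> C_class l D" for W
    using that by (auto simp: C_class_def is_domain_def)
  have 1: "\<exists>\<Omega>\<^sub>\<epsilon>. connected \<Omega>\<^sub>\<epsilon> \<and> open \<Omega>\<^sub>\<epsilon> \<and> smooth_boundary \<Omega>\<^sub>\<epsilon> \<and> \<Omega>\<^sub>\<epsilon> \<Subset> \<Omega> \<and>
      finite (components (closure D - \<Omega>\<^sub>\<epsilon>)) \<and>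
      card (components (closure D - \<Omega>\<^sub>\<epsilon>)) \<le> card (components (closure D - \<Omega>)) \<and>
      \<Omega> - \<Omega>\<^sub>\<epsilon> \<subseteq> {x \<in> \<Omega>. infdist x (frontier \<Omega>) < \<epsilon>} \<and>
      complementary_hausdorff_distance D \<Omega>\<^sub>\<epsilon> \<Omega> \<le> \<epsilon>"
    if \<epsilon>: "0 < \<epsilon> \<and> \<epsilon> < 1" for \<epsilon> :: real
    by (rule smooth_domain_inner_approximation[OF D cls(1-5)[OF assms(4)] conjunct1[OF \<epsilon>]])
      (intro exI conjI, assumption+)
  have 2: "\<exists>\<Omega>''\<in>C_class l D. smooth_boundary \<Omega>'' \<and> complementary_hausdorff_distance D \<Omega>'' \<Omega>' < \<delta>"
    if \<Omega>': "\<Omega>' \<in> C_class l D" and "0 < \<delta>" for \<Omega>' and \<delta> :: real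
  proof -
    have "\<delta> / 2 > 0" using \<open>0 < \<delta>\<close> by simp
    obtain V where V: "V \<noteq> {}" "connected V" "open V" "smooth_boundary V" "V \<Subset> \<Omega>'"
      "finite (components (closure D - V))"
      "card (components (closure D - V)) \<le> card (components (closure D - \<Omega>'))"
      "complementary_hausdorff_distance D V \<Omega>' \<le> \<delta> / 2"
      by (rule smooth_domain_inner_approximation[OF D cls(1-5)[OF \<Omega>'] \<open>\<delta> / 2 > 0\<close>]) (rule that)
    have "V \<subseteq> D"
      using V(5) cls(4)[OF \<Omega>'] closure_subset[of V] unfolding compactly_contained_def by blast
    with V cls(6)[OF \<Omega>'] have "V \<in> C_class l D"
      by (simp add: C_class_def is_domain_def)
    moreover have "complementary_hausdorff_distance D V \<Omega>' < \<delta>" using V(8) \<open>0 < \<delta>\<close> by linarith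
    ultimately show ?thesis using V(4) by blast
  qed
  show ?thesis
    by (intro conjI exI[of _ "1::real"] allI impI ballI zero_less_one) (rule 1 2; assumption)+
qed

end
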